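(* Let $M$ be an algebra with a differential structure, equipped with a bimodule covariant derivative $(\nabla,\sigma)$ on $\Omega^1M$ for which the interior product is compatible with the differential calculus. Let $X(t)\in\mathrm{Vec}\,M$ be a time dependent vector field, and let $K^n_X(t)\in L(\Omega^nM,\Omega^nM)$ (for all $n\ge0$) be its exponentiation, defined by $$\dot K^n_X(t)=K^n_X(t)\circ\mathcal L_{X(t)},\qquad K^n_X(0)=\mathrm{id}.$$ Then the sequence of maps $K^*_X(t):\Omega^*M\to\Omega^*M$ is a cochain complex map, i.e. $$d\circ K^n_X(t)=K^{n+1}_X(t)\circ d:\Omega^nM\to\Omega^{n+1}M.$$
   Context: All algebras are unital and associative. A differential structure on $M$ is a graded algebra $\Omega^nM$, $n\ge0$, with product $\wedge:\Omega^nM\otimes\Omega^mM\to\Omega^{n+m}M$ and $\Omega^0M=M$ (so every $\Omega^nM$ is an $M$-bimodule, with the actions written with a dot), together with a differential $d:\Omega^nM\to\Omega^{n+1}M$ with $d^2=0$ and $d(\tau\wedge\omega)=d\tau\wedge\omega+(-1)^{|\tau|}\tau\wedge d\omega$ (where $|\tau|=n$ for $\tau\in\Omega^nM$), such that $M.d\Omega^nM$ and $d\Omega^nM.M$ are dense in $\Omega^{n+1}M$. All right modules considered, in particular $\Omega^1M$ as a right $M$-module, are assumed finitely generated projective. A bimodule covariant derivative on $\Omega^1M$ is a pair $(\nabla,\sigma)$, where $\nabla:\Omega^1M\to\Omega^1M\otimes_M\Omega^1M$ satisfies $\nabla(m.\xi)=dm\otimes\xi+m.\nabla\xi$, and $\sigma:\Omega^1M\otimes_M\Omega^1M\to\Omega^1M\otimes_M\Omega^1M$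 is an $M$-bimodule map with $\nabla(\xi.m)=\nabla(\xi).m+\sigma(\xi\otimes dm)$, for all $m\in M$, $\xi\in\Omega^1M$; $\sigma$ is assumed invertible. $\mathrm{Vec}\,M$ is the set of right $M$-module maps $\Omega^1M\to M$, with evaluation map $\mathrm{ev}:\mathrm{Vec}\,M\otimes_M\Omega^1M\to M$. On $\bigotimes^n_M\Omega^1M$ put $\sigma_1=\mathrm{id}$, $\sigma_2=\sigma$, $\sigma_{n+1}=(\sigma\otimes\mathrm{id}^{n-1})(\mathrm{id}\otimes\sigma_n)$ and $T_n=-\sum_{r=1}^n(-1)^r\sigma_r\otimes\mathrm{id}^{n-r}$, where $\mathrm{id}^k$ is the $k$-fold tensor product of identity maps, and let $\Theta^nM=\ker(\wedge:\bigotimes^n_M\Omega^1M\to\Omega^nM)$. For $X\in\mathrm{Vec}\,M$ and $z\in\bigotimes_M^n\Omega^1M$, the interior product is $X\lrcorner z=(\mathrm{ev}\otimes\mathrm{id}^{n-1})(X\otimes T_n(z))$. It is compatible with the differential calculus if $T_{n+1}(\Theta^{n+1}M)\subset\Omega^1M\otimes_M\Theta^nM$ for all $n\ge1$; it then gives an interior product $\lrcorner:\mathrm{Vec}\,M\otimes_M\Omega^{n+1}M\to\Omega^nM$, and by convention $X\lrcorner m=0$ for $m\in\Omega^0M=M$. The Lie derivative of $\omega\in\Omega^nM$ with respect to $X$ is $\mathcal L_X\omega=X\lrcorner(d\omega)+d(X\lrcorner\omega)$. $L(A,B)$ denotes the linear maps from $A$ to $B$, and the dot over $K$ denotes the derivative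 with respect to $t$.
   Formalization: Each Ω^nM carries a vector space topology with point-separating continuous dual and continuous d; K^n_X(t) are continuous linear maps and K^n_X is assumed to be the unique such solution of its initial value problem (with arbitrary linear maps the claim fails, e.g. on the circle). *)

theory Defs
  imports "HOL-Analysis.Analysis" "HOL-Algebra.Free_Abelian_Groups" "HOL-Algebra.Generated_Groups"
begin

type_synonym 'w tensor = "('w list \<Rightarrow>\<^sub>0 int) set"

definition additive_group :: "'w::ab_group_add set \<Rightarrow> 'w monoid" where
  "additive_group A = \<lparr>carrier = A, monoid.mult = (+), one = 0\<rparr>"

definition right_module_map :: "'w::ring_1 set \<Rightarrow> 'w set \<Rightarrow> 'w set \<Rightarrow> ('w \<Rightarrow> 'w) \<Rightarrow> bool" where
  "right_module_map M P Q f \<longleftrightarrow> f \<in> P \<rightarrow> Q \<and>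
     (\<forall>x\<in>P. \<forall>y\<in>P. f (x + y) = f x + f y) \<and> (\<forall>x\<in>P. \<forall>m\<in>M. f (x * m) = f x * m)"

text \<open>The right \<open>M\<close>-module \<open>P\<close> is a direct summand of a free module \<open>M\<^sup>N\<close>. A map into or out of
  \<open>M\<^sup>N\<close> is a function of \<open>i < N\<close>; elements of \<open>M\<^sup>N\<close> are functions on \<open>nat\<close> vanishing from \<open>N\<close> on.\<close>

definition fg_projective :: "'w::ring_1 set \<Rightarrow> 'w set \<Rightarrow> bool" where
  "fg_projective M P \<longleftrightarrow> (\<exists>N (inc :: 'w \<Rightarrow> nat \<Rightarrow> 'w) (prj :: (nat \<Rightarrow> 'w) \<Rightarrow> 'w).
     let F = {v. (\<forall>i<N. v i \<in> M) \<and> (\<forall>i\<ge>N. v i = 0)} in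
       inc \<in> P \<rightarrow> F \<and>
       (\<forall>x\<in>P. \<forall>y\<in>P. inc (x + y) = (\<lambda>i. inc x i + inc y i)) \<and>
       (\<forall>x\<in>P. \<forall>m\<in>M. inc (x * m) = (\<lambda>i. inc x i * m)) \<and>
       prj \<in> F \<rightarrow> P \<and>
       (\<forall>u\<in>F. \<forall>v\<in>F. prj (\<lambda>i. u i + v i) = prj u + prj v) \<and>
       (\<forall>u\<in>F. \<forall>m\<in>M. prj (\<lambda>i. u i * m) = prj u * m) \<and>
       (\<forall>x\<in>P. prj (inc x) = x))"

text \<open>The graded algebra is internal: \<open>Om n\<close> is the space \<open>\<Omega>\<^sup>nM\<close> inside an ambient ring \<open>'w\<close>
  whose product is \<open>\<and>\<close>; the algebra \<open>M\<close> is \<open>Om 0\<close>, and its actions are products in the ring.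
  The scalars \<open>'k\<close> are the real or the complex numbers.

  Density and time derivatives refer to a vector space topology \<open>Tp n\<close> on each \<open>Om n\<close> for which
  \<open>d\<close> is continuous. Instead of asking that it be Hausdorff and locally convex, we only ask for what
  Hahn--Banach gives in that case: the continuous functionals separate points. The finest locally
  convex topology is allowed; every linear map is then continuous and every linear subspace is
  closed, so that dense means equal.\<close>

locale differential_structure = vector_space scale
  for scale :: "'k::real_normed_field \<Rightarrow> 'w::ring_1 \<Rightarrow> 'w"
    and Om :: "nat \<Rightarrow> 'w set"
    and d :: "'w \<Rightarrow> 'w"
    and Tp :: "nat \<Rightarrow> 'w topology" +
  assumes scale_mult_left: "scale c x * y = scale c (x * y)"
    and scale_mult_right: "x * scale c y = scale c (x * y)"
    and subspace_Om: "subspace (Om n)"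
    and one_Om: "1 \<in> Om 0"
    and mult_Om: "\<lbrakk>x \<in> Om m; y \<in> Om n\<rbrakk> \<Longrightarrow> x * y \<in> Om (m + n)"
    and direct_Om: "\<lbrakk>\<And>i. i \<le> N \<Longrightarrow> f i \<in> Om i; (\<Sum>i\<le>N. f i) = 0; j \<le> N\<rbrakk> \<Longrightarrow> f j = 0"
    and d_closed: "x \<in> Om n \<Longrightarrow> d x \<in> Om (Suc n)"
    and d_add: "\<lbrakk>x \<in> Om n; y \<in> Om n\<rbrakk> \<Longrightarrow> d (x + y) = d x + d y"
    and d_scale: "x \<in> Om n \<Longrightarrow> d (scale c x) = scale c (d x)"
    and d_d: "x \<in> Om n \<Longrightarrow> d (d x) = 0"
    and d_mult: "\<lbrakk>x \<in> Om m; y \<in> Om n\<rbrakk> \<Longrightarrow> d (x * y) = d x * y + (-1) ^ m * (x * d y)"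
    and topspace_Tp: "topspace (Tp n) = Om n"
    and continuous_add:
      "continuous_map (prod_topology (Tp n) (Tp n)) (Tp n) (\<lambda>(x, y). x + y)"
    and continuous_scale:
      "continuous_map (prod_topology euclidean (Tp n)) (Tp n) (\<lambda>(c, x). scale c x)"
    and separating_dual: "\<lbrakk>x \<in> Om n; x \<noteq> 0\<rbrakk> \<Longrightarrow>
      \<exists>\<phi> :: 'w \<Rightarrow> 'k. continuous_map (Tp n) euclidean \<phi> \<and>
        (\<forall>y\<in>Om n. \<forall>z\<in>Om n. \<phi> (y + z) = \<phi> y + \<phi> z) \<and>
        (\<forall>c. \<forall>y\<in>Om n. \<phi> (scale c y) = c * \<phi> y) \<and> \<phi> x \<noteq> 0"
    and continuous_d: "continuous_map (Tp n) (Tp (Suc n)) d"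
    and dense_M_d: "Tp (Suc n) closure_of span {m * d x |m x. m \<in> Om 0 \<and> x \<in> Om n} = Om (Suc n)"
    and dense_d_M: "Tp (Suc n) closure_of span {d x * m |m x. m \<in> Om 0 \<and> x \<in> Om n} = Om (Suc n)"
    and fg_projective_Om1: "fg_projective (Om 0) (Om 1)"
begin

definition linear_map :: "nat \<Rightarrow> nat \<Rightarrow> ('w \<Rightarrow> 'w) \<Rightarrow> bool" where
  "linear_map m n f \<longleftrightarrow> f \<in> Om m \<rightarrow> Om n \<and>
     (\<forall>x\<in>Om m. \<forall>y\<in>Om m. f (x + y) = f x + f y) \<and>
     (\<forall>c. \<forall>x\<in>Om m. f (scale c x) = scale c (f x))"

definition Vec :: "('w \<Rightarrow> 'w) set" where
  "Vec = {X. right_module_map (Om 0) (Om 1) (Om 0) X}"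

subsection \<open>Tensor powers of the one-forms\<close>

text \<open>\<open>Tens n\<close> is \<open>\<Otimes>\<^sup>n\<^sub>M \<Omega>\<^sup>1M\<close>, the free abelian group on words of one-forms modulo additivity in
  each letter and \<open>M\<close>-balancing of neighbouring letters. Its group operation, written as
  multiplication in the library, is addition of tensors. For \<open>n = 0\<close> the words are single letters
  from \<open>M\<close>, so that \<open>Tens 0\<close> is a copy of \<open>M\<close>. Scalars need no separate relation, as they lie
  in \<open>M\<close>.\<close>

definition words :: "nat \<Rightarrow> 'w list set" where
  "words n = (if n = 0 then {[m] |m. m \<in> Om 0} else {w. length w = n \<and> set w \<subseteq> Om 1})"

definition tensor_relators :: "nat \<Rightarrow> ('w list \<Rightarrow>\<^sub>0 int) set" where
  "tensor_relators n =
     {frag_of (u @ [a + b] @ v) - frag_of (u @ [a] @ v) - frag_of (u @ [b] @ v) |u a b v.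
        u @ [a] @ v \<in> words n \<and> u @ [b] @ v \<in> words n} \<union>
     {frag_of (u @ [a * m, b] @ v) - frag_of (u @ [a, m * b] @ v) |u a m b v.
        m \<in> Om 0 \<and> u @ [a, b] @ v \<in> words n}"

definition tensor_null :: "nat \<Rightarrow> ('w list \<Rightarrow>\<^sub>0 int) set" where
  "tensor_null n = generate (free_Abelian_group (words n)) (tensor_relators n)"

definition Tens :: "nat \<Rightarrow> 'w tensor monoid" where
  "Tens n = free_Abelian_group (words n) Mod tensor_null n"

definition elem :: "nat \<Rightarrow> 'w list \<Rightarrow> 'w tensor" where
  "elem n w = tensor_null n #>\<^bsub>free_Abelian_group (words n)\<^esub> frag_of w"

text \<open>The additive map on \<open>Tens n\<close> with prescribed values \<open>h w\<close> on elementary tensors. It is unique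
  on the carrier, and exists if \<open>h\<close> is additive and balanced, as in all uses below.\<close>

definition tensor_extend ::
    "nat \<Rightarrow> ('c, 'e) monoid_scheme \<Rightarrow> ('w list \<Rightarrow> 'c) \<Rightarrow> 'w tensor \<Rightarrow> 'c" where
  "tensor_extend n G h = (SOME g. g \<in> hom (Tens n) G \<and> (\<forall>w\<in>words n. g (elem n w) = h w))"

definition left_act :: "nat \<Rightarrow> 'w \<Rightarrow> 'w tensor \<Rightarrow> 'w tensor" where
  "left_act n m = tensor_extend n (Tens n) (\<lambda>w. elem n ((m * hd w) # tl w))"

definition right_act :: "nat \<Rightarrow> 'w tensor \<Rightarrow> 'w \<Rightarrow> 'w tensor" where
  "right_act n z m = tensor_extend n (Tens n) (\<lambda>w. elem n (butlast w @ [last w * m])) z"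

text \<open>\<open>v \<mapsto> \<xi> \<otimes> v\<close> for a one-form \<open>\<xi>\<close> and \<open>v \<in> Tens n\<close>, \<open>n \<ge> 1\<close>;
  \<open>z \<mapsto> z \<otimes> v\<close> for \<open>z \<in> Tens p\<close>, \<open>p \<ge> 1\<close>, and a (possibly empty) word \<open>v\<close> of \<open>k\<close> one-forms.\<close>

definition cons_tensor :: "nat \<Rightarrow> 'w \<Rightarrow> 'w tensor \<Rightarrow> 'w tensor" where
  "cons_tensor n \<xi> = tensor_extend n (Tens (Suc n)) (\<lambda>w. elem (Suc n) (\<xi> # w))"

definition append_tensor :: "nat \<Rightarrow> nat \<Rightarrow> 'w tensor \<Rightarrow> 'w list \<Rightarrow> 'w tensor" where
  "append_tensor p k z v = tensor_extend p (Tens (p + k)) (\<lambda>u. elem (p + k) (u @ v)) z"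

text \<open>\<open>id \<otimes> f\<close> and \<open>f \<otimes> id\<^sup>k\<close> for bimodule endomorphisms \<open>f\<close> of \<open>Tens n\<close> and \<open>Tens p\<close>.\<close>

definition id_tensor ::
    "nat \<Rightarrow> ('w tensor \<Rightarrow> 'w tensor) \<Rightarrow> 'w tensor \<Rightarrow> 'w tensor" where
  "id_tensor n f =
     tensor_extend (Suc n) (Tens (Suc n)) (\<lambda>w. cons_tensor n (hd w) (f (elem n (tl w))))"

definition tensor_id ::
    "nat \<Rightarrow> ('w tensor \<Rightarrow> 'w tensor) \<Rightarrow> nat \<Rightarrow> 'w tensor \<Rightarrow> 'w tensor" where
  "tensor_id p f k =
     tensor_extend (p + k) (Tens (p + k))
       (\<lambda>w. append_tensor p k (f (elem p (take p w))) (drop p w))"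

definition wedge :: "nat \<Rightarrow> 'w tensor \<Rightarrow> 'w" where
  "wedge n = tensor_extend n (additive_group (Om n)) prod_list"

definition Theta :: "nat \<Rightarrow> 'w tensor set" where
  "Theta n = kernel (Tens n) (additive_group (Om n)) (wedge n)"

subsection \<open>Bimodule covariant derivatives and the interior product\<close>

definition bimodule_covariant_derivative ::
    "('w \<Rightarrow> 'w tensor) \<Rightarrow> ('w tensor \<Rightarrow> 'w tensor) \<Rightarrow> bool" where
  "bimodule_covariant_derivative nabla \<sigma> \<longleftrightarrow>
     nabla \<in> hom (additive_group (Om 1)) (Tens 2) \<and>
     \<sigma> \<in> iso (Tens 2) (Tens 2) \<and>
     (\<forall>m\<in>Om 0. \<forall>z\<in>carrier (Tens 2). \<sigma> (left_act 2 m z) = left_act 2 m (\<sigma> z)) \<and>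
     (\<forall>m\<in>Om 0. \<forall>z\<in>carrier (Tens 2). \<sigma> (right_act 2 z m) = right_act 2 (\<sigma> z) m) \<and>
     (\<forall>m\<in>Om 0. \<forall>\<xi>\<in>Om 1. nabla (m * \<xi>) = elem 2 [d m, \<xi>] \<otimes>\<^bsub>Tens 2\<^esub> left_act 2 m (nabla \<xi>)) \<and>
     (\<forall>m\<in>Om 0. \<forall>\<xi>\<in>Om 1. nabla (\<xi> * m) = right_act 2 (nabla \<xi>) m \<otimes>\<^bsub>Tens 2\<^esub> \<sigma> (elem 2 [\<xi>, d m]))"

fun sigma_pow ::
    "('w tensor \<Rightarrow> 'w tensor) \<Rightarrow> nat \<Rightarrow> 'w tensor \<Rightarrow> 'w tensor" where
  "sigma_pow \<sigma> 0 = id"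
| "sigma_pow \<sigma> (Suc 0) = id"
| "sigma_pow \<sigma> (Suc (Suc 0)) = \<sigma>"
| "sigma_pow \<sigma> (Suc (Suc (Suc k))) =
     tensor_id 2 \<sigma> (Suc k) \<circ> id_tensor (Suc (Suc k)) (sigma_pow \<sigma> (Suc (Suc k)))"

text \<open>In additive notation, \<open>T\<^sub>n z = - (\<Sum>r=1..n. (-1)\<^sup>r (\<sigma>\<^sub>r \<otimes> id\<^sup>n\<^sup>-\<^sup>r) z)\<close>.\<close>

definition T_map ::
    "('w tensor \<Rightarrow> 'w tensor) \<Rightarrow> nat \<Rightarrow> 'w tensor \<Rightarrow> 'w tensor" where
  "T_map \<sigma> n z =
     inv\<^bsub>Tens n\<^esub> (finprod (Tens n)
       (\<lambda>r. tensor_id r (sigma_pow \<sigma> r) (n - r) z [^]\<^bsub>Tens n\<^esub> ((-1) ^ r :: int)) {1..n})"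

text \<open>\<open>ev \<otimes> id\<^sup>n\<close> applied to \<open>X \<otimes> z\<close>, for \<open>z \<in> Tens (n + 1)\<close>\<close>

definition contract :: "('w \<Rightarrow> 'w) \<Rightarrow> nat \<Rightarrow> 'w tensor \<Rightarrow> 'w tensor" where
  "contract X n = tensor_extend (Suc n) (Tens n)
     (\<lambda>w. elem n (case tl w of [] \<Rightarrow> [X (hd w)] | \<eta> # v \<Rightarrow> (X (hd w) * \<eta>) # v))"

definition interior_tensor ::
    "('w tensor \<Rightarrow> 'w tensor) \<Rightarrow> ('w \<Rightarrow> 'w) \<Rightarrow> nat \<Rightarrow> 'w tensor \<Rightarrow> 'w tensor" where
  "interior_tensor \<sigma> X n z = contract X n (T_map \<sigma> (Suc n) z)"

definition interior_compatible ::
    "('w tensor \<Rightarrow> 'w tensor) \<Rightarrow> bool" where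
  "interior_compatible \<sigma> \<longleftrightarrow> (\<forall>n\<ge>1. T_map \<sigma> (Suc n) ` Theta (Suc n) \<subseteq>
     generate (Tens (Suc n)) {cons_tensor n \<xi> z |\<xi> z. \<xi> \<in> Om 1 \<and> z \<in> Theta n})"

text \<open>\<open>\<iota>\<close> is the interior product with \<open>X\<close>, as a map from \<open>Om (n + 1)\<close> to \<open>Om n\<close>: the one induced
  through \<open>\<and>\<close> by the interior product on tensors. As the differential calculus only makes the
  image of \<open>\<and>\<close> dense in general, the induced map is then extended by continuity, that is, within
  the closure of its graph; if \<open>\<and>\<close> is onto, the last condition follows from the one before.\<close>

definition is_interior_product ::
    "('w tensor \<Rightarrow> 'w tensor) \<Rightarrow> ('w \<Rightarrow> 'w) \<Rightarrow> nat \<Rightarrow> ('w \<Rightarrow> 'w) \<Rightarrow> bool" where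
  "is_interior_product \<sigma> X n \<iota> \<longleftrightarrow>
     linear_map (Suc n) n \<iota> \<and>
     (\<forall>z\<in>carrier (Tens (Suc n)). \<iota> (wedge (Suc n) z) = wedge n (interior_tensor \<sigma> X n z)) \<and>
     (\<forall>\<omega>\<in>Om (Suc n). (\<omega>, \<iota> \<omega>) \<in> prod_topology (Tp (Suc n)) (Tp n) closure_of
        {(wedge (Suc n) z, wedge n (interior_tensor \<sigma> X n z)) |z. z \<in> carrier (Tens (Suc n))})"

text \<open>Here \<open>ip X n\<close> is the interior product with \<open>X\<close> from \<open>Om (n + 1)\<close> to \<open>Om n\<close>.\<close>

definition Lie :: "(('w \<Rightarrow> 'w) \<Rightarrow> nat \<Rightarrow> 'w \<Rightarrow> 'w) \<Rightarrow> ('w \<Rightarrow> 'w) \<Rightarrow> nat \<Rightarrow> 'w \<Rightarrow> 'w" where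
  "Lie ip X n \<omega> = ip X n (d \<omega>) + d (case n of 0 \<Rightarrow> 0 | Suc k \<Rightarrow> ip X k \<omega>)"

subsection \<open>Exponentiation\<close>

definition has_time_derivative ::
    "nat \<Rightarrow> (real \<Rightarrow> 'w) \<Rightarrow> 'w \<Rightarrow> real \<Rightarrow> real set \<Rightarrow> bool" where
  "has_time_derivative n f f' t J \<longleftrightarrow>
     limitin (Tp n) (\<lambda>s. scale (of_real (1 / (s - t))) (f s - f t)) f' (at t within J)"

definition solves_exponential ::
    "nat \<Rightarrow> real set \<Rightarrow> (real \<Rightarrow> 'w \<Rightarrow> 'w) \<Rightarrow> (real \<Rightarrow> 'w \<Rightarrow> 'w) \<Rightarrow> bool" where
  "solves_exponential n J L K \<longleftrightarrow>
     (\<forall>t\<in>J. linear_map n n (K t) \<and> continuous_map (Tp n) (Tp n) (K t)) \<and>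
     (\<forall>\<omega>\<in>Om n. K 0 \<omega> = \<omega>) \<and>
     (\<forall>t\<in>J. \<forall>\<omega>\<in>Om n. has_time_derivative n (\<lambda>s. K s \<omega>) (K t (L t \<omega>)) t J)"

text \<open>That the initial value problem defines \<open>K\<close> means that \<open>K\<close> is its only solution. Uniqueness is
  not automatic for unbounded \<open>L\<close>, and without it \<open>K\<close> could be chosen independently in different
  degrees. It is understood among continuous linear maps: already for smooth functions on a
  circle, the flow of a constant vector field is not unique among all linear maps.\<close>

definition is_exponentiation ::
    "nat \<Rightarrow> real set \<Rightarrow> (real \<Rightarrow> 'w \<Rightarrow> 'w) \<Rightarrow> (real \<Rightarrow> 'w \<Rightarrow> 'w) \<Rightarrow> bool" where
  "is_exponentiation n J L K \<longleftrightarrow> solves_exponential n J L K \<and>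
     (\<forall>K'. solves_exponential n J L K' \<longrightarrow> (\<forall>t\<in>J. \<forall>\<omega>\<in>Om n. K' t \<omega> = K t \<omega>))"

end

end

theory Submission
  imports Defs
begin

text \<open>Put \<open>D t = d \<circ> K\<^sup>n t - K\<^sup>n\<^sup>+\<^sup>1 t \<circ> d\<close>. As \<open>d\<close> commutes with the Lie derivative,
  \<open>D\<close> solves \<open>D' = D \<circ> \<L>\<close> with \<open>D 0 = 0\<close>. Uniqueness is only known for maps from \<open>\<Omega>\<^sup>n\<close> to itself,
  but for a continuous functional \<open>\<phi>\<close> on \<open>\<Omega>\<^sup>n\<^sup>+\<^sup>1\<close> and a vector \<open>v\<close> in \<open>\<Omega>\<^sup>n\<close>, the maps
  \<open>\<omega> \<mapsto> K\<^sup>n t \<omega> + \<phi> (D t \<omega>) v\<close> solve the problem that defines \<open>K\<^sup>n\<close>.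
  Hence \<open>\<phi> (D t \<omega>) v = 0\<close>, and \<open>D t = 0\<close> because the functionals separate points.\<close>

context differential_structure
begin

section \<open>Linear algebra and continuous functionals on the graded pieces\<close>

lemma zero_in_Om: "0 \<in> Om n"
  and add_in_Om: "\<lbrakk>x \<in> Om n; y \<in> Om n\<rbrakk> \<Longrightarrow> x + y \<in> Om n"
  and diff_in_Om: "\<lbrakk>x \<in> Om n; y \<in> Om n\<rbrakk> \<Longrightarrow> x - y \<in> Om n"
  and scale_in_Om: "x \<in> Om n \<Longrightarrow> scale c x \<in> Om n"
  using subspace_Om[of n] subspace_0 subspace_add subspace_diff subspace_scale by blast+

lemma linear_map_closed: "\<lbrakk>linear_map m n f; x \<in> Om m\<rbrakk> \<Longrightarrow> f x \<in> Om n"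
  and linear_map_add:
    "\<lbrakk>linear_map m n f; x \<in> Om m; y \<in> Om m\<rbrakk> \<Longrightarrow> f (x + y) = f x + f y"
  and linear_map_scale:
    "\<lbrakk>linear_map m n f; x \<in> Om m\<rbrakk> \<Longrightarrow> f (scale c x) = scale c (f x)"
  by (auto simp: linear_map_def)

lemma linear_map_zero: "linear_map m n f \<Longrightarrow> f 0 = 0"
  using linear_map_scale[of m n f 0 0] zero_in_Om by simp

lemma linear_map_d: "linear_map n (Suc n) d"
  by (auto simp: linear_map_def d_closed d_add d_scale)

text \<open>The functionals supplied by \<open>separating_dual\<close>. As functions are total,
  linearity is asked for on \<open>Om n\<close> only.\<close>

definition continuous_functional :: "nat \<Rightarrow> ('w \<Rightarrow> 'k) \<Rightarrow> bool" where
  "continuous_functional n \<phi> \<longleftrightarrow> continuous_map (Tp n) euclidean \<phi> \<and>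
     (\<forall>y\<in>Om n. \<forall>z\<in>Om n. \<phi> (y + z) = \<phi> y + \<phi> z) \<and>
     (\<forall>c. \<forall>y\<in>Om n. \<phi> (scale c y) = c * \<phi> y)"

lemma functional_diff:
  assumes "continuous_functional n \<phi>" "x \<in> Om n" "y \<in> Om n"
  shows "\<phi> (x - y) = \<phi> x - \<phi> y"
proof -
  have "\<phi> (x - y + y) = \<phi> (x - y) + \<phi> y"
    using assms diff_in_Om unfolding continuous_functional_def by blast
  then show ?thesis by simp
qed

lemma functional_compose:
  assumes "continuous_functional n \<phi>" "linear_map m n f" "continuous_map (Tp m) (Tp n) f"
  shows "continuous_functional m (\<lambda>x. \<phi> (f x))"
  using assms continuous_map_compose[OF assms(3), of euclidean \<phi>]
  by (auto simp: continuous_functional_def linear_map_def o_def Pi_iff)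

lemma functional_difference:
  assumes "continuous_functional n \<phi>" "continuous_functional n \<psi>"
  shows "continuous_functional n (\<lambda>x. \<phi> x - \<psi> x)"
  using assms by (auto simp: continuous_functional_def algebra_simps intro!: continuous_intros)

text \<open>Separation applied to \<open>x - y\<close>. This reduces an identity of forms to
  identities of scalars.\<close>

lemma functional_eqI:
  assumes "x \<in> Om n" "y \<in> Om n"
    and "\<And>\<phi>. continuous_functional n \<phi> \<Longrightarrow> \<phi> x = \<phi> y"
  shows "x = y"
proof (rule ccontr)
  assume "x \<noteq> y"
  then obtain \<phi> where \<phi>: "continuous_functional n \<phi>" "\<phi> (x - y) \<noteq> 0"
    using separating_dual[OF diff_in_Om[OF assms(1,2)]] unfolding continuous_functional_def by auto
  then show False
    using functional_diff[OF \<phi>(1) assms(1,2)] assms(3)[OF \<phi>(1)] by simp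
qed

section \<open>Continuity and limits in the topologies \<open>Tp n\<close>\<close>

lemma continuous_map_add_Tp:
  assumes "continuous_map Y (Tp n) f" "continuous_map Y (Tp n) g"
  shows "continuous_map Y (Tp n) (\<lambda>x. f x + g x)"
proof -
  have "continuous_map Y (prod_topology (Tp n) (Tp n)) (\<lambda>x. (f x, g x))"
    using assms by (simp add: continuous_map_pairedI)
  from continuous_map_compose[OF this continuous_add] show ?thesis by (simp add: o_def)
qed

lemma continuous_map_scale_vector:
  assumes "v \<in> Om n"
  shows "continuous_map euclidean (Tp n) (\<lambda>c. scale c v)"
proof -
  have "continuous_map euclidean (prod_topology euclidean (Tp n)) (\<lambda>c. (c, v))"
    using assms by (simp add: continuous_map_pairedI topspace_Tp)
  from continuous_map_compose[OF this continuous_scale] show ?thesis by (simp add: o_def)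
qed

lemma limitin_add_Tp:
  assumes "limitin (Tp n) f a F" "limitin (Tp n) g b F"
  shows "limitin (Tp n) (\<lambda>x. f x + g x) (a + b) F"
proof -
  have "limitin (prod_topology (Tp n) (Tp n)) (\<lambda>x. (f x, g x)) (a, b) F"
    using assms by (simp add: limitin_pairwise o_def)
  from continuous_map_limit[OF continuous_add this] show ?thesis by (simp add: o_def)
qed

text \<open>A continuous functional passes through the limit, and by linearity through the
  difference quotient.\<close>

lemma has_time_derivative_functional:
  assumes "has_time_derivative n f f' t J" "continuous_functional n \<phi>"
    and "t \<in> J" "\<And>s. s \<in> J \<Longrightarrow> f s \<in> Om n"
  shows "((\<lambda>s. of_real (1 / (s - t)) * (\<phi> (f s) - \<phi> (f t))) \<longlongrightarrow> \<phi> f') (at t within J)"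
proof -
  have "continuous_map (Tp n) euclidean \<phi>"
    using assms(2) by (simp add: continuous_functional_def)
  from continuous_map_limit[OF this assms(1)[unfolded has_time_derivative_def]]
  have lim: "((\<lambda>s. \<phi> (scale (of_real (1 / (s - t))) (f s - f t))) \<longlongrightarrow> \<phi> f') (at t within J)"
    by (simp add: o_def)
  have "\<phi> (scale c (f s - f t)) = c * (\<phi> (f s) - \<phi> (f t))" if "s \<in> J" for s c
    using assms that functional_diff[OF assms(2)] diff_in_Om
    unfolding continuous_functional_def by metis
  \<comment> \<open>Linearity of \<open>\<phi>\<close> applies where \<open>f s\<close> lies in
    \<open>Om n\<close>, which is known for \<open>s \<in> J\<close>; this is enough for a limit
    within \<open>J\<close>.\<close>
  then have "\<forall>\<^sub>F s in at t within J. \<phi> (scale (of_real (1 / (s - t))) (f s - f t))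
      = of_real (1 / (s - t)) * (\<phi> (f s) - \<phi> (f t))"
    by (auto simp: eventually_at_filter)
  from Lim_transform_eventually[OF lim this] show ?thesis .
qed

section \<open>The initial value problem and its uniqueness\<close>

lemma solves_exponential_linear_map:
  "\<lbrakk>solves_exponential n J L K; t \<in> J\<rbrakk> \<Longrightarrow> linear_map n n (K t)"
  and solves_exponential_continuous:
  "\<lbrakk>solves_exponential n J L K; t \<in> J\<rbrakk> \<Longrightarrow> continuous_map (Tp n) (Tp n) (K t)"
  and solves_exponential_initial:
  "\<lbrakk>solves_exponential n J L K; \<omega> \<in> Om n\<rbrakk> \<Longrightarrow> K 0 \<omega> = \<omega>"
  and solves_exponential_derivative:
  "\<lbrakk>solves_exponential n J L K; t \<in> J; \<omega> \<in> Om n\<rbrakk> \<Longrightarrow>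
     has_time_derivative n (\<lambda>s. K s \<omega>) (K t (L t \<omega>)) t J"
  by (auto simp: solves_exponential_def)

text \<open>The equation is linear in the unknown and composes with \<open>L t\<close> on the right.
  So a scalar solution \<open>h\<close> with zero initial value, multiplied by a fixed vector, can
  be added to \<open>K\<close>.\<close>

lemma solves_exponential_rank_one_perturbation:
  assumes K: "solves_exponential n J L K" and v: "v \<in> Om n"
    and h: "\<And>t. t \<in> J \<Longrightarrow> continuous_functional n (h t)"
    and h0: "\<And>\<omega>. \<omega> \<in> Om n \<Longrightarrow> h 0 \<omega> = 0"
    and h': "\<And>t \<omega>. \<lbrakk>t \<in> J; \<omega> \<in> Om n\<rbrakk> \<Longrightarrow>
      ((\<lambda>s. of_real (1 / (s - t)) * (h s \<omega> - h t \<omega>)) \<longlongrightarrow> h t (L t \<omega>)) (at t within J)"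
  shows "solves_exponential n J L (\<lambda>t \<omega>. K t \<omega> + scale (h t \<omega>) v)"
  unfolding solves_exponential_def
proof (intro conjI ballI)
  fix t assume t: "t \<in> J"
  note Kt = solves_exponential_linear_map[OF K t] and ht = h[OF t]
  show "linear_map n n (\<lambda>\<omega>. K t \<omega> + scale (h t \<omega>) v)"
    using ht linear_map_add[OF Kt] linear_map_scale[OF Kt] linear_map_closed[OF Kt]
    unfolding linear_map_def[of n n "\<lambda>\<omega>. K t \<omega> + scale (h t \<omega>) v"] continuous_functional_def
    by (auto simp: algebra_simps intro!: add_in_Om scale_in_Om v)
  have "continuous_map (Tp n) euclidean (h t)"
    using ht by (simp add: continuous_functional_def)
  from continuous_map_compose[OF this continuous_map_scale_vector[OF v]]
  have "continuous_map (Tp n) (Tp n) (\<lambda>\<omega>. scale (h t \<omega>) v)"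
    by (simp add: o_def)
  then show "continuous_map (Tp n) (Tp n) (\<lambda>\<omega>. K t \<omega> + scale (h t \<omega>) v)"
    by (intro continuous_map_add_Tp solves_exponential_continuous[OF K t])
next
  fix \<omega> assume "\<omega> \<in> Om n"
  then show "K 0 \<omega> + scale (h 0 \<omega>) v = \<omega>"
    using h0 solves_exponential_initial[OF K] by simp
next
  fix t \<omega> assume t: "t \<in> J" and \<omega>: "\<omega> \<in> Om n"
  \<comment> \<open>The continuous map \<open>c \<mapsto> scale c v\<close> will carry this scalar
    limit into \<open>Tp n\<close>.\<close>
  have "limitin euclidean (\<lambda>s. of_real (1 / (s - t)) * (h s \<omega> - h t \<omega>)) (h t (L t \<omega>)) (at t within J)"
    using h'[OF t \<omega>] by simp
  from continuous_map_limit[OF continuous_map_scale_vector[OF v] this]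
  have "limitin (Tp n) (\<lambda>s. scale (of_real (1 / (s - t)) * (h s \<omega> - h t \<omega>)) v)
      (scale (h t (L t \<omega>)) v) (at t within J)"
    by (simp add: o_def)
  from limitin_add_Tp[OF solves_exponential_derivative[OF K t \<omega>, unfolded has_time_derivative_def] this]
  show "has_time_derivative n (\<lambda>s. K s \<omega> + scale (h s \<omega>) v)
      (K t (L t \<omega>) + scale (h t (L t \<omega>)) v) t J"
    unfolding has_time_derivative_def by (simp add: algebra_simps diff_divide_distrib)
qed

text \<open>The perturbed family is another solution, so \<open>scale (h t \<omega>) v = 0\<close>,
  and \<open>v \<noteq> 0\<close> forces the scalar to vanish. Uniqueness for endomorphisms thus
  passes to functionals.\<close>

lemma exponentiation_functional_unique:
  assumes K: "is_exponentiation n J L K" and v: "v \<in> Om n" "v \<noteq> 0"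
    and h: "\<And>t. t \<in> J \<Longrightarrow> continuous_functional n (h t)"
    and h0: "\<And>\<omega>. \<omega> \<in> Om n \<Longrightarrow> h 0 \<omega> = 0"
    and h': "\<And>t \<omega>. \<lbrakk>t \<in> J; \<omega> \<in> Om n\<rbrakk> \<Longrightarrow>
      ((\<lambda>s. of_real (1 / (s - t)) * (h s \<omega> - h t \<omega>)) \<longlongrightarrow> h t (L t \<omega>)) (at t within J)"
    and "t \<in> J" "\<omega> \<in> Om n"
  shows "h t \<omega> = 0"
proof -
  have "solves_exponential n J L (\<lambda>t \<omega>. K t \<omega> + scale (h t \<omega>) v)"
    using K v h h0 h'
    by (intro solves_exponential_rank_one_perturbation) (auto simp: is_exponentiation_def)
  then have "K t \<omega> + scale (h t \<omega>) v = K t \<omega>"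
    using K assms(7,8) unfolding is_exponentiation_def by blast
  then show ?thesis using v by simp
qed

text \<open>Both \<open>A \<circ> K t\<close> and \<open>K' t \<circ> A\<close> solve
  \<open>F' = F \<circ> L\<close> with initial value \<open>A\<close>. Testing against functionals
  on \<open>Om p\<close> lets uniqueness in the source \<open>Om n\<close> decide; \<open>K'\<close>
  enters as a solution.\<close>

lemma exponentiation_intertwines:
  assumes K: "is_exponentiation n J L K" and K': "solves_exponential p J L' K'"
    and A: "linear_map n p A" "continuous_map (Tp n) (Tp p) A"
    and L: "\<And>t \<omega>. \<lbrakk>t \<in> J; \<omega> \<in> Om n\<rbrakk> \<Longrightarrow> L t \<omega> \<in> Om n"
    and AL: "\<And>t \<omega>. \<lbrakk>t \<in> J; \<omega> \<in> Om n\<rbrakk> \<Longrightarrow> A (L t \<omega>) = L' t (A \<omega>)"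
    and J: "0 \<in> J" and t: "t \<in> J" and \<omega>: "\<omega> \<in> Om n"
  shows "A (K t \<omega>) = K' t (A \<omega>)"
\<comment> \<open>The rank-one perturbation requires a nonzero vector in \<open>Om n\<close>:
  \<open>\<omega>\<close> itself serves, unless it is 0, where linearity settles the claim.\<close>
proof (cases "\<omega> = 0")
  case True
  have "linear_map n n (K t)" "linear_map p p (K' t)"
    using K K' t unfolding is_exponentiation_def
    by (blast intro: solves_exponential_linear_map)+
  then show ?thesis using True A(1) by (simp add: linear_map_zero)
next
  case False
  have K1: "solves_exponential n J L K"
    using K by (simp add: is_exponentiation_def)
  note lin = solves_exponential_linear_map[OF K1] solves_exponential_linear_map[OF K']
  note cont = solves_exponential_continuous[OF K1] solves_exponential_continuous[OF K']
  note A_closed = linear_map_closed[OF A(1)]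
  show ?thesis
  proof (rule functional_eqI)
    show "A (K t \<omega>) \<in> Om p" "K' t (A \<omega>) \<in> Om p"
      using lin t \<omega> A_closed linear_map_closed by blast+
  next
    fix \<phi> assume \<phi>: "continuous_functional p \<phi>"
    \<comment> \<open>The failure of \<open>A\<close> to intertwine, seen through
      \<open>\<phi>\<close>; a functional on \<open>Om n\<close> for each time.\<close>
    define h where "h t \<omega> = \<phi> (A (K t \<omega>)) - \<phi> (K' t (A \<omega>))" for t \<omega>
    note \<phi>A = functional_compose[OF \<phi> A]
    have "h t \<omega> = 0"
    proof (rule exponentiation_functional_unique[OF K \<omega> False _ _ _ t \<omega>])
      fix t assume t: "t \<in> J"
      note \<phi>K' = functional_compose[OF \<phi> lin(2)[OF t] cont(2)[OF t]]
      show "continuous_functional n (h t)"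
        unfolding h_def
        by (rule functional_difference[OF functional_compose[OF \<phi>A lin(1)[OF t] cont(1)[OF t]]
              functional_compose[OF \<phi>K' A]])
    next
      fix \<omega> assume "\<omega> \<in> Om n"
      then show "h 0 \<omega> = 0"
        using solves_exponential_initial[OF K1] solves_exponential_initial[OF K'] A_closed
        by (simp add: h_def)
    next
      fix t \<omega> assume t: "t \<in> J" and \<omega>: "\<omega> \<in> Om n"
      note d1 = has_time_derivative_functional[OF solves_exponential_derivative[OF K1 t \<omega>] \<phi>A t
          linear_map_closed[OF lin(1) \<omega>]]
      note d2 = has_time_derivative_functional[OF solves_exponential_derivative[OF K' t A_closed[OF \<omega>]]
          \<phi> t linear_map_closed[OF lin(2) A_closed[OF \<omega>]]]
      \<comment> \<open>\<open>d1\<close> tests \<open>K\<close> against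
        \<open>\<phi> \<circ> A\<close>, and \<open>d2\<close> tests \<open>K'\<close> at
        \<open>A \<omega>\<close> against \<open>\<phi>\<close>. By \<open>AL\<close>, the second
        limit is \<open>\<phi> (K' t (A (L t \<omega>)))\<close>, so the difference is
        \<open>h t (L t \<omega>)\<close>.\<close>
      from tendsto_diff[OF d1 d2]
      show "((\<lambda>s. of_real (1 / (s - t)) * (h s \<omega> - h t \<omega>)) \<longlongrightarrow> h t (L t \<omega>)) (at t within J)"
        by (simp add: h_def AL[OF t \<omega>] algebra_simps)
    qed
    then show "\<phi> (A (K t \<omega>)) = \<phi> (K' t (A \<omega>))"
      by (simp add: h_def)
  qed
qed

section \<open>The Lie derivative and its commutation with \<open>d\<close>\<close>

lemma Lie_closed:
  assumes "\<And>n. linear_map (Suc n) n (ip X n)" "\<omega> \<in> Om n"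
  shows "Lie ip X n \<omega> \<in> Om n"
  using assms linear_map_closed[OF assms(1)] linear_map_zero[OF linear_map_d]
  unfolding Lie_def by (cases n) (auto intro!: add_in_Om zero_in_Om d_closed)

text \<open>Since \<open>d\<close> squares to zero, both sides reduce to
  \<open>d (ip X n (d \<omega>))\<close>: one loses \<open>d (d (ip X k \<omega>))\<close>, the
  other \<open>ip X (Suc n) (d (d \<omega>))\<close>.\<close>

lemma d_Lie:
  assumes "\<And>n. linear_map (Suc n) n (ip X n)" "\<omega> \<in> Om n"
  shows "d (Lie ip X n \<omega>) = Lie ip X (Suc n) (d \<omega>)"
proof -
  \<comment> \<open>Some degree must be named for \<open>d_d\<close>. For \<open>n = 0\<close>
    truncated subtraction gives degree 0, harmless as the value is 0.\<close>
  have i: "(case n of 0 \<Rightarrow> 0 | Suc k \<Rightarrow> ip X k \<omega>) \<in> Om (n - 1)"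
    using assms linear_map_closed[OF assms(1)] by (cases n) (auto simp: zero_in_Om)
  \<comment> \<open>Not a consequence of \<open>i\<close> for \<open>n = 0\<close>, where
    \<open>d_closed\<close> would land in \<open>Om 1\<close>; there the value is
    \<open>d 0 = 0\<close>.\<close>
  have "d (case n of 0 \<Rightarrow> 0 | Suc k \<Rightarrow> ip X k \<omega>) \<in> Om n"
    using assms linear_map_closed[OF assms(1)] linear_map_zero[OF linear_map_d]
    by (cases n) (auto intro!: zero_in_Om d_closed)
  then have "d (Lie ip X n \<omega>) = d (ip X n (d \<omega>)) + d (d (case n of 0 \<Rightarrow> 0 | Suc k \<Rightarrow> ip X k \<omega>))"
    using linear_map_closed[OF assms(1) d_closed[OF assms(2)]] unfolding Lie_def
    by (simp add: d_add)
  also have "\<dots> = Lie ip X (Suc n) (d \<omega>)"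
    using d_d[OF i] d_d[OF assms(2)] linear_map_zero[OF assms(1)] by (simp add: Lie_def)
  finally show ?thesis .
qed

end

theorem proposition16p2:
  fixes scale :: "'k::real_normed_field \<Rightarrow> 'w::ring_1 \<Rightarrow> 'w"
    and Om :: "nat \<Rightarrow> 'w set"
    and d :: "'w \<Rightarrow> 'w"
    and Tp :: "nat \<Rightarrow> 'w topology"
    and nabla :: "'w \<Rightarrow> 'w tensor"
    and \<sigma> :: "'w tensor \<Rightarrow> 'w tensor"
    and ip :: "('w \<Rightarrow> 'w) \<Rightarrow> nat \<Rightarrow> 'w \<Rightarrow> 'w"
    and J :: "real set"
    and X :: "real \<Rightarrow> 'w \<Rightarrow> 'w"
    and K :: "nat \<Rightarrow> real \<Rightarrow> 'w \<Rightarrow> 'w"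
  assumes "differential_structure scale Om d Tp"
    and "differential_structure.bimodule_covariant_derivative Om d nabla \<sigma>"
    and "differential_structure.interior_compatible Om \<sigma>"
    and "\<And>Y n. Y \<in> differential_structure.Vec Om \<Longrightarrow>
           differential_structure.is_interior_product scale Om Tp \<sigma> Y n (ip Y n)"
    and "is_interval J" and "0 \<in> J"
    and "\<And>t. t \<in> J \<Longrightarrow> X t \<in> differential_structure.Vec Om"
    and "\<And>n. differential_structure.is_exponentiation scale Om Tp n J
           (\<lambda>t. differential_structure.Lie d ip (X t) n) (K n)"
  shows "\<forall>n. \<forall>t\<in>J. \<forall>\<omega>\<in>Om n. d (K n t \<omega>) = K (Suc n) t (d \<omega>)"
proof (intro allI ballI)
  interpret differential_structure scale Om d Tp by fact
  fix n t \<omega> assume t: "t \<in> J" and \<omega>: "\<omega> \<in> Om n"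
  have ip: "linear_map (Suc n) n (ip (X s) n)" if "s \<in> J" for s n
    using assms(4)[OF assms(7)[OF that]] by (simp add: is_interior_product_def)
  have "solves_exponential (Suc n) J (\<lambda>t. Lie ip (X t) (Suc n)) (K (Suc n))"
    using assms(8) by (simp add: is_exponentiation_def)
  \<comment> \<open>Intertwining with \<open>A = d\<close> and \<open>p = Suc n\<close>:
    \<open>d_Lie\<close> gives the commutation, and \<open>continuous_d\<close> makes functionals on
    \<open>Om (Suc n)\<close> pull back to \<open>Om n\<close>.\<close>
  then show "d (K n t \<omega>) = K (Suc n) t (d \<omega>)"
    using ip \<open>0 \<in> J\<close> t \<omega>
    by (intro exponentiation_intertwines[OF assms(8) _ linear_map_d continuous_d])
      (auto intro: Lie_closed d_Lie)
qed

end
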